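(* A DFS traversal of a directed graph $G$ with $n$ vertices and $m$ edges can be performed in $O(n+m)$ time using $2m+3n+o(m+n)$ bits of working space. For undirected graphs, the space required is $4m+3n+o(m+n)$ bits.
   Context: Model: the input graph is in read-only memory as an adjacency list with cross pointers. For undirected graphs: given a vertex $u$ and the position in its list of a neighbour $v$, there is a pointer to the position of $u$ in the list of $v$. For directed graphs: each vertex has an out-neighbour list and an in-neighbour list, and for each edge $(u,v)$, given $u$ and the position of $v$ in the out-list of $u$, there is a pointer to the position of $u$ in the in-list of $v$. Only additional workspace is counted, in bits, on a word RAM with words of $\Omega(\lg n)$ bits. As a standing assumption of the paper, the input graph is connected, so $m\ge n-1$. *)

theory Defs
  imports
    "Graph_Theory.Graph_Theory"
    "HOL-Library.Landau_Symbols"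
begin

section \<open>Depth-first traversals\<close>

datatype event = Discover nat | Finish nat

text \<open>
  \<open>dfs_from G st V es\<close>: with the vertices on the stack \<open>st\<close> (top first) active and the vertices
  in \<open>V\<close> discovered so far, \<open>es\<close> is a possible continuation of a depth-first traversal. From the top
  of the stack the search moves to any undiscovered out-neighbour, and it backtracks only if there
  is none. A new root is chosen only when the stack is empty, and the traversal ends when all
  vertices are finished.
\<close>

inductive dfs_from :: "nat pair_pre_digraph \<Rightarrow> nat list \<Rightarrow> nat set \<Rightarrow> event list \<Rightarrow> bool"
  for G :: "nat pair_pre_digraph"
where
  stop: "V = pverts G \<Longrightarrow> dfs_from G [] V []"
| root: "v \<in> pverts G \<Longrightarrow> v \<notin> V \<Longrightarrow> dfs_from G [v] (insert v V) es \<Longrightarrow>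
    dfs_from G [] V (Discover v # es)"
| advance: "(u, v) \<in> parcs G \<Longrightarrow> v \<notin> V \<Longrightarrow> dfs_from G (v # u # st) (insert v V) es \<Longrightarrow>
    dfs_from G (u # st) V (Discover v # es)"
| backtrack: "(\<And>v. (u, v) \<in> parcs G \<Longrightarrow> v \<in> V) \<Longrightarrow> dfs_from G st V es \<Longrightarrow>
    dfs_from G (u # st) V (Finish u # es)"

definition dfs_traversal :: "nat pair_pre_digraph \<Rightarrow> event list \<Rightarrow> bool" where
  "dfs_traversal G es \<longleftrightarrow> dfs_from G [] {} es"

section \<open>Read-only adjacency lists with cross pointers\<close>

record adjacency =
  num_vertices :: nat
  out_list :: "nat \<Rightarrow> nat list"
  in_list :: "nat \<Rightarrow> nat list"
  cross_pointer :: "nat \<Rightarrow> nat \<Rightarrow> nat"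

text \<open>
  The lists may be in any order. Cross pointers lead from out-lists to in-lists only:
  \<open>cross_pointer I u i\<close> is the position of \<open>u\<close> in the in-list of the \<open>i\<close>-th out-neighbour of \<open>u\<close>.
\<close>

definition stores_digraph :: "adjacency \<Rightarrow> nat pair_pre_digraph \<Rightarrow> bool" where
  "stores_digraph I G \<longleftrightarrow>
     pverts G = {..<num_vertices I} \<and>
     (\<forall>v\<in>pverts G.
        distinct (out_list I v) \<and> set (out_list I v) = {u. (v, u) \<in> parcs G} \<and>
        distinct (in_list I v) \<and> set (in_list I v) = {u. (u, v) \<in> parcs G}) \<and>
     (\<forall>u\<in>pverts G. \<forall>i<length (out_list I u).
        let v = out_list I u ! i; j = cross_pointer I u i
        in j < length (in_list I v) \<and> in_list I v ! j = u)"

text \<open>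
  An undirected graph is a symmetric digraph, as in \<^locale>\<open>pair_graph\<close>. It has a single list per
  vertex; both \<^const>\<open>out_list\<close> and \<^const>\<open>in_list\<close> refer to that list.
\<close>

definition stores_graph :: "adjacency \<Rightarrow> nat pair_pre_digraph \<Rightarrow> bool" where
  "stores_graph I G \<longleftrightarrow>
     stores_digraph I G \<and> (\<forall>v\<in>pverts G. in_list I v = out_list I v)"

definition undirected_edges :: "nat pair_pre_digraph \<Rightarrow> nat set set" where
  "undirected_edges G = (\<lambda>(u, v). {u, v}) ` parcs G"

section \<open>A word RAM with read-only input and write-only output\<close>

datatype binop = Add | Sub | Mul | Div | Mod | And | Or | Xor | Shl | Shr | Less | Equal

datatype exp =
    Lit nat
  | Reg nat
  | Word_Length
  | Num_Vertices
  | Out_Degree exp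
  | Out_Neighbour exp exp
  | In_Degree exp
  | In_Neighbour exp exp
  | Cross_Pointer exp exp
  | Bin binop exp exp

datatype com =
    Skip
  | Assign nat exp
  | Load nat exp
  | Store exp exp
  | Output exp
  | Seq com com
  | Cond exp com com
  | While exp com

fun apply_binop :: "nat \<Rightarrow> binop \<Rightarrow> nat \<Rightarrow> nat \<Rightarrow> nat" where
  "apply_binop w Add a b = a + b"
| "apply_binop w Sub a b = 2 ^ w + a - b"
| "apply_binop w Mul a b = a * b"
| "apply_binop w Div a b = a div b"
| "apply_binop w Mod a b = a mod b"
| "apply_binop w And a b = and a b"
| "apply_binop w Or a b = or a b"
| "apply_binop w Xor a b = xor a b"
| "apply_binop w Shl a b = push_bit b a"
| "apply_binop w Shr a b = drop_bit b a"
| "apply_binop w Less a b = of_bool (a < b)"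
| "apply_binop w Equal a b = of_bool (a = b)"

definition list_entry :: "nat list \<Rightarrow> nat \<Rightarrow> nat" where
  "list_entry xs i = (if i < length xs then xs ! i else 0)"

text \<open>All values are words of \<open>w\<close> bits: every result is reduced modulo \<open>2 ^ w\<close>.\<close>

fun eval :: "nat \<Rightarrow> adjacency \<Rightarrow> (nat \<Rightarrow> nat) \<Rightarrow> exp \<Rightarrow> nat" where
  "eval w I r (Lit k) = take_bit w k"
| "eval w I r (Reg x) = take_bit w (r x)"
| "eval w I r Word_Length = take_bit w w"
| "eval w I r Num_Vertices = take_bit w (num_vertices I)"
| "eval w I r (Out_Degree a) = take_bit w (length (out_list I (eval w I r a)))"
| "eval w I r (Out_Neighbour a b) =
     take_bit w (list_entry (out_list I (eval w I r a)) (eval w I r b))"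
| "eval w I r (In_Degree a) = take_bit w (length (in_list I (eval w I r a)))"
| "eval w I r (In_Neighbour a b) =
     take_bit w (list_entry (in_list I (eval w I r a)) (eval w I r b))"
| "eval w I r (Cross_Pointer a b) =
     take_bit w (cross_pointer I (eval w I r a) (eval w I r b))"
| "eval w I r (Bin f a b) = take_bit w (apply_binop w f (eval w I r a) (eval w I r b))"

fun exp_nodes :: "exp \<Rightarrow> nat" where
  "exp_nodes (Lit k) = 1"
| "exp_nodes (Reg x) = 1"
| "exp_nodes Word_Length = 1"
| "exp_nodes Num_Vertices = 1"
| "exp_nodes (Out_Degree a) = 1 + exp_nodes a"
| "exp_nodes (Out_Neighbour a b) = 1 + exp_nodes a + exp_nodes b"
| "exp_nodes (In_Degree a) = 1 + exp_nodes a"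
| "exp_nodes (In_Neighbour a b) = 1 + exp_nodes a + exp_nodes b"
| "exp_nodes (Cross_Pointer a b) = 1 + exp_nodes a + exp_nodes b"
| "exp_nodes (Bin f a b) = 1 + exp_nodes a + exp_nodes b"

fun com_nodes :: "com \<Rightarrow> nat" where
  "com_nodes Skip = 1"
| "com_nodes (Assign x a) = 1 + exp_nodes a"
| "com_nodes (Load x a) = 1 + exp_nodes a"
| "com_nodes (Store a b) = 1 + exp_nodes a + exp_nodes b"
| "com_nodes (Output a) = 1 + exp_nodes a"
| "com_nodes (Seq c d) = 1 + com_nodes c + com_nodes d"
| "com_nodes (Cond a c d) = 1 + exp_nodes a + com_nodes c + com_nodes d"
| "com_nodes (While a c) = 1 + exp_nodes a + com_nodes c"

record state =
  regs :: "nat \<Rightarrow> nat"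
  memory :: "nat \<Rightarrow> nat"
  output_tape :: "nat list"

definition initial_state :: state where
  "initial_state = \<lparr>regs = (\<lambda>_. 0), memory = (\<lambda>_. 0), output_tape = []\<rparr>"

text \<open>
  \<open>exec w M I c s t s'\<close>: with words of \<open>w\<close> bits, a read-write memory of \<open>M\<close> words and read-only
  input \<open>I\<close>, command \<open>c\<close> takes state \<open>s\<close> to \<open>s'\<close> in \<open>t\<close> steps. Evaluating an expression takes one step
  per operation. There is no execution that accesses an address outside the \<open>M\<close> words, and the
  output cannot be read back.
\<close>

inductive exec :: "nat \<Rightarrow> nat \<Rightarrow> adjacency \<Rightarrow> com \<Rightarrow> state \<Rightarrow> nat \<Rightarrow> state \<Rightarrow> bool"
  for w M :: nat and I :: adjacency
where
  skip: "exec w M I Skip s 1 s"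
| assign: "exec w M I (Assign x a) s (1 + exp_nodes a)
    (s\<lparr>regs := (regs s)(x := eval w I (regs s) a)\<rparr>)"
| load: "p = eval w I (regs s) a \<Longrightarrow> p < M \<Longrightarrow>
    exec w M I (Load x a) s (1 + exp_nodes a) (s\<lparr>regs := (regs s)(x := memory s p)\<rparr>)"
| store: "p = eval w I (regs s) a \<Longrightarrow> p < M \<Longrightarrow>
    exec w M I (Store a b) s (1 + exp_nodes a + exp_nodes b)
      (s\<lparr>memory := (memory s)(p := eval w I (regs s) b)\<rparr>)"
| emit: "exec w M I (Output a) s (1 + exp_nodes a)
    (s\<lparr>output_tape := output_tape s @ [eval w I (regs s) a]\<rparr>)"
| seq: "exec w M I c s t s' \<Longrightarrow> exec w M I d s' t' s'' \<Longrightarrow>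
    exec w M I (Seq c d) s (1 + t + t') s''"
| cond_true: "eval w I (regs s) a \<noteq> 0 \<Longrightarrow> exec w M I c s t s' \<Longrightarrow>
    exec w M I (Cond a c d) s (1 + exp_nodes a + t) s'"
| cond_false: "eval w I (regs s) a = 0 \<Longrightarrow> exec w M I d s t s' \<Longrightarrow>
    exec w M I (Cond a c d) s (1 + exp_nodes a + t) s'"
| while_false: "eval w I (regs s) a = 0 \<Longrightarrow>
    exec w M I (While a c) s (1 + exp_nodes a) s"
| while_true: "eval w I (regs s) a \<noteq> 0 \<Longrightarrow> exec w M I c s t s' \<Longrightarrow>
    exec w M I (While a c) s' t' s'' \<Longrightarrow>
    exec w M I (While a c) s (1 + exp_nodes a + t + t') s''"

fun encode_event :: "event \<Rightarrow> nat list" where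
  "encode_event (Discover v) = [0, v]"
| "encode_event (Finish v) = [1, v]"

text \<open>
  The workspace comprises the \<open>M\<close> words of memory and one word for each node of the program. The
  latter is an upper bound on the number of registers and temporary values of expressions.
\<close>

definition performs_dfs ::
  "com \<Rightarrow> nat \<Rightarrow> adjacency \<Rightarrow> nat pair_pre_digraph \<Rightarrow> real \<Rightarrow> real \<Rightarrow> bool" where
  "performs_dfs P w I G time space \<longleftrightarrow>
     (\<exists>M t s es.
        exec w M I P initial_state t s \<and>
        real t \<le> time \<and>
        real (w * (M + com_nodes P)) \<le> space \<and>
        dfs_traversal G es \<and>
        output_tape s = concat (map encode_event es))"

section \<open>Asymptotics in the numbers of vertices and edges\<close>

abbreviation graph_size :: "nat \<times> nat \<Rightarrow> real" where
  "graph_size \<equiv> \<lambda>(n, m). real (n + m)"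

definition large_graphs :: "(nat \<times> nat) filter" where
  "large_graphs = filtercomap graph_size at_top"

text \<open>
  A simple graph has at most \<open>n\<^sup>2\<close> edges, so words of \<open>lg (n + m) + O(1)\<close> bits have \<open>\<Theta>(lg n)\<close> bits.
  Any machine uses at least one word, so a space bound with the error term \<open>o(n + m)\<close> presupposes
  a word length in \<open>o(n + m)\<close>.
\<close>

end

theory Submission
  imports Defs
begin

text \<open>
  The stack of the search stores, for each tree edge \<open>(u, v)\<close>, the position \<open>i\<close> of \<open>v\<close> in the out-list
  of \<open>u\<close> and the position \<open>j\<close> of \<open>u\<close> in the in-list of \<open>v\<close>, which the cross pointer supplies. When the
  search retreats from \<open>v\<close>, the in-degree of \<open>v\<close> is the radix that allows us to pop \<open>j\<close>; then \<open>u\<close> is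
  known, and its out-degree is the radix that allows us to pop \<open>i\<close>. So no directory of offsets is
  needed. The numbers are packed greedily into words. A word together with the first number of the
  next one has at least \<open>w - 1\<close> bits, so the number \<open>k\<close> of full words satisfies \<open>2 ^ ((w - 1) * k) \<le> Q\<^sup>2\<close>
  for the product \<open>Q\<close> of all radices on the stack. Every in- and out-degree occurs at most once as a
  radix, and \<open>d\<^sup>2 \<le> 2 ^ (d + 1)\<close>, whence \<open>Q\<^sup>2 \<le> 2 ^ (2 * m + 2 * n)\<close>. Together with a bitmap of the
  discovered vertices this amounts to \<open>2 * m + 3 * n\<close> bits, up to lower-order terms. Undirected
  graphs are the special case of \<open>2 * m\<close> arcs.
\<close>

section \<open>Loop-free programs\<close>

text \<open>A functional counterpart of \<open>exec\<close>, so that loop-free code can be executed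
  symbolically by rewriting. The result \<open>None\<close> stands for an address outside the memory
  or for a loop.\<close>

fun run :: "nat \<Rightarrow> nat \<Rightarrow> adjacency \<Rightarrow> com \<Rightarrow> state \<Rightarrow> state option" where
  "run w M I Skip s = Some s"
| "run w M I (Assign x a) s = Some (s\<lparr>regs := (regs s)(x := eval w I (regs s) a)\<rparr>)"
| "run w M I (Load x a) s =
     (if eval w I (regs s) a < M
      then Some (s\<lparr>regs := (regs s)(x := memory s (eval w I (regs s) a))\<rparr>) else None)"
| "run w M I (Store a b) s =
     (if eval w I (regs s) a < M
      then Some (s\<lparr>memory := (memory s)(eval w I (regs s) a := eval w I (regs s) b)\<rparr>) else None)"
| "run w M I (Output a) s = Some (s\<lparr>output_tape := output_tape s @ [eval w I (regs s) a]\<rparr>)"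
| "run w M I (Seq c d) s = Option.bind (run w M I c s) (run w M I d)"
| "run w M I (Cond a c d) s =
     (if eval w I (regs s) a \<noteq> 0 then run w M I c s else run w M I d s)"
| "run w M I (While a c) s = None"

text \<open>Without loops every node of the program is executed at most once, so its size bounds the
  time. Hence one iteration of the main loop takes constant time.\<close>

lemma exec_if_run:
  "run w M I c s = Some s' \<Longrightarrow> \<exists>t\<le>com_nodes c. exec w M I c s t s'"
proof (induction c arbitrary: s s')
  case (Seq c d)
  then obtain s1 where s1: "run w M I c s = Some s1" "run w M I d s1 = Some s'"
    by (auto simp: Option.bind_eq_Some_conv)
  obtain t1 where "t1 \<le> com_nodes c" "exec w M I c s t1 s1"
    using Seq.IH(1)[OF s1(1)] by blast
  moreover obtain t2 where "t2 \<le> com_nodes d" "exec w M I d s1 t2 s'"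
    using Seq.IH(2)[OF s1(2)] by blast
  ultimately show ?case
    by (intro exI[of _ "1 + t1 + t2"] conjI exec.seq) auto
next
  case (Cond a c d)
  show ?case
  proof (cases "eval w I (regs s) a = 0")
    case True
    then obtain t where "t \<le> com_nodes d" "exec w M I d s t s'"
      using Cond.IH(2)[of s s'] Cond.prems True by auto
    then show ?thesis
      using True by (intro exI[of _ "1 + exp_nodes a + t"] conjI exec.cond_false) auto
  next
    case False
    then obtain t where "t \<le> com_nodes c" "exec w M I c s t s'"
      using Cond.IH(1)[of s s'] Cond.prems False by auto
    then show ?thesis
      using False by (intro exI[of _ "1 + exp_nodes a + t"] conjI exec.cond_true) auto
  qed
qed (auto split: if_splits simp del: eval.simps
       intro: order_refl exec.skip[simplified] exec.assign[simplified] exec.load[OF refl, simplified]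
         exec.store[OF refl, simplified] exec.emit[simplified])

section \<open>A stack of bounded numbers packed into words\<close>

text \<open>
  An item \<open>(x, d)\<close> is a number \<open>x < d\<close>; only \<open>x\<close> has to be stored, since \<open>d\<close> is known again when
  the item is popped. A word is a mixed-radix number with a leading digit 1, so that the value 1
  means that it is empty. The test for an overflow avoids the number \<open>2 ^ w\<close>, which does not fit
  into a word; an item with \<open>d = 1\<close> never causes an overflow.
\<close>

fun push_item :: "nat \<Rightarrow> nat \<times> nat \<Rightarrow> nat \<times> nat list \<Rightarrow> nat \<times> nat list" where
  "push_item w (x, d) (cur, ws) =
     (if (2 ^ w - d) div d < cur then (d + x, cur # ws) else (cur * d + x, ws))"

definition packed :: "nat \<Rightarrow> (nat \<times> nat) list \<Rightarrow> nat \<times> nat list" where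
  "packed w items = foldr (push_item w) items (1, [])"

text \<open>The second condition makes room for the first item of a new word, whose value
  \<open>d + x\<close> is below \<open>2 * d\<close>.\<close>

definition valid_item :: "nat \<Rightarrow> nat \<times> nat \<Rightarrow> bool" where
  "valid_item w = (\<lambda>(x, d). x < d \<and> 2 * d \<le> 2 ^ w)"

lemma packed_simps [simp]:
  "packed w [] = (1, [])"
  "packed w (item # items) = push_item w item (packed w items)"
  by (simp_all add: packed_def)

lemma no_overflow:
  fixes cur d x q :: nat
  assumes "cur \<le> (q - d) div d" "x < d" "d \<le> q"
  shows "cur * d + x < q"
proof -
  have "cur * d \<le> q - d"
    using mult_le_mono1[OF assms(1)] div_times_less_eq_dividend order_trans by blast
  then show ?thesis
    using assms by linarith
qed

lemma overflow:
  fixes cur d q :: nat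
  assumes "(q - d) div d < cur" "0 < d" "d \<le> q"
  shows "q \<le> (cur + 1) * d"
proof -
  have "q - d < cur * d"
    using assms by (simp add: div_less_iff_less_mult)
  then show ?thesis
    by (simp add: algebra_simps)
qed

text \<open>Each push multiplies the right side of the last bound by \<open>d ^ 2\<close>. Without
  overflow the left side grows at most by the factor \<open>d\<close>. On overflow,
  \<open>2 ^ w <= (c + 1) * d\<close> pays for the new factor \<open>2 ^ (w - 1)\<close>, and the
  new word satisfies \<open>cur + 1 <= 2 * d\<close>. The bound \<open>2 <= cur\<close> is what lets
  a pop distinguish a used word above others from an empty one.\<close>

lemma packed_bounds:
  assumes "\<forall>item\<in>set items. valid_item w item" "0 < w" "packed w items = (cur, ws)"
  shows "1 \<le> cur \<and> cur < 2 ^ w \<and> (ws \<noteq> [] \<longrightarrow> 2 \<le> cur) \<and> (\<forall>c\<in>set ws. c < 2 ^ w) \<and>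
    2 ^ ((w - 1) * length ws) * (cur + 1) \<le> 2 * prod_list (map snd items) ^ 2"
  using assms(1,3)
proof (induction items arbitrary: cur ws)
  case Nil
  then show ?case
    using assms(2) one_less_power[of "2::nat" w] by auto
next
  case (Cons item items)
  obtain x d where item: "item = (x, d)" by force
  obtain c cs where p: "packed w items = (c, cs)" by force
  have xd: "x < d" "2 * d \<le> 2 ^ w"
    using Cons.prems by (auto simp: item valid_item_def)
  define Q where "Q = prod_list (map snd items)"
  define A where "A = (2::nat) ^ ((w - 1) * length cs)"
  have IH: "1 \<le> c" "c < 2 ^ w" "cs \<noteq> [] \<longrightarrow> 2 \<le> c" "\<forall>c\<in>set cs. c < 2 ^ w"
      "A * (c + 1) \<le> 2 * Q ^ 2"
    using Cons.IH[OF _ p] Cons.prems(1) by (auto simp: Q_def A_def)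
  show ?case
  proof (cases "(2 ^ w - d) div d < c")
    case True
    then have eq: "cur = d + x" "ws = c # cs"
      using Cons.prems(2) by (simp_all add: item p)
    have ov: "2 ^ w \<le> (c + 1) * d"
      using overflow[OF True] xd by simp
    \<comment> \<open>An item of radix 1 always fits, so a newly opened word has value at least 2
      and cannot be mistaken for an empty one.\<close>
    have d2: "2 \<le> d"
    proof (rule ccontr)
      assume "\<not> 2 \<le> d"
      then have "d = 1" using xd by simp
      then show False using True IH(2) by simp
    qed
    have "2 ^ ((w - 1) * length ws) * (cur + 1) \<le> A * 2 ^ (w - 1) * (2 * d)"
      using xd by (intro mult_mono) (simp_all add: eq A_def power_add)
    also have "\<dots> = A * 2 ^ w * d"
      using assms(2) by (cases w) (simp_all add: algebra_simps)
    also have "\<dots> \<le> A * ((c + 1) * d) * d"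
      using ov by simp
    also have "\<dots> = A * (c + 1) * d ^ 2"
      by (simp add: power2_eq_square algebra_simps)
    also have "\<dots> \<le> 2 * Q ^ 2 * d ^ 2"
      using IH(5) by (rule mult_le_mono1)
    finally have "2 ^ ((w - 1) * length ws) * (cur + 1) \<le> 2 * (d * Q) ^ 2"
      by (simp add: power_mult_distrib algebra_simps)
    then show ?thesis
      using IH xd d2 by (auto simp: eq item Q_def)
  next
    case False
    then have eq: "cur = c * d + x" "ws = cs"
      using Cons.prems(2) by (simp_all add: item p)
    have "c * d + x < 2 ^ w"
      using no_overflow[of c "2 ^ w" d x] False xd by simp
    moreover have "c \<le> cur"
      using xd by (simp add: eq trans_le_add1)
    moreover have "A * (cur + 1) \<le> 2 * (d * Q) ^ 2"
    proof -
      have "cur + 1 \<le> (c + 1) * d"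
        using xd by (simp add: eq)
      then have "A * (cur + 1) \<le> A * ((c + 1) * d)"
        by (rule mult_le_mono2)
      also have "\<dots> \<le> 2 * Q ^ 2 * d"
        using mult_le_mono1[OF IH(5), of d] by (simp only: mult.assoc)
      also have "\<dots> \<le> 2 * Q ^ 2 * d ^ 2"
        by (simp add: power2_eq_square)
      finally show ?thesis
        by (simp add: power_mult_distrib algebra_simps)
    qed
    ultimately show ?thesis
      using IH unfolding eq item Q_def A_def by auto
  qed
qed

fun stack_in_memory :: "(nat \<Rightarrow> nat) \<Rightarrow> nat \<Rightarrow> nat list \<Rightarrow> bool" where
  "stack_in_memory f b [] = True"
| "stack_in_memory f b (c # ws) = (f (b + length ws) = c \<and> stack_in_memory f b ws)"

lemma stack_in_memory_update_above:
  "b + length ws \<le> p \<Longrightarrow> stack_in_memory (f(p := c)) b ws = stack_in_memory f b ws"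
  by (induction ws) auto

lemma stack_in_memory_update_below:
  "p < b \<Longrightarrow> stack_in_memory (f(p := c)) b ws = stack_in_memory f b ws"
  by (induction ws) auto

section \<open>The program\<close>

text \<open>
  Registers: 0 next candidate for a root, 1 whether a search is active, 2 top vertex of the stack,
  3 next position in its out-list, 4 word at the top of the packed stack, 5 address of the next
  word of the packed stack, 6 vertex to be tested or discovered, 7 word of the bitmap that contains
  this vertex, 8 and 9 item \<open>x\<close> and radix \<open>d\<close> to be pushed or popped. The bitmap of discovered
  vertices precedes the packed stack in memory.
\<close>

abbreviation stack_base :: exp where
  "stack_base \<equiv> Bin Add (Bin Div Num_Vertices Word_Length) (Lit 1)"

text \<open>Subtraction wraps around, so \<open>0 - d\<close> yields \<open>2 ^ w - d\<close>. After
  an overflow the current word is reset to the empty value 1, and the same final assignment then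
  produces \<open>d + x\<close>.\<close>

definition push_com :: com where
  "push_com =
     Seq (Cond (Bin Less (Bin Div (Bin Sub (Lit 0) (Reg 9)) (Reg 9)) (Reg 4))
            (Seq (Store (Reg 5) (Reg 4))
              (Seq (Assign 5 (Bin Add (Reg 5) (Lit 1)))
                (Assign 4 (Lit 1))))
            Skip)
       (Assign 4 (Bin Add (Bin Mul (Reg 4) (Reg 9)) (Reg 8)))"

text \<open>A quotient of 1 means that the popped item was the first of its word, so the previous
  full word is reloaded. The address comparison excludes the bottom word, which has no
  predecessor.\<close>

definition pop_com :: com where
  "pop_com =
     Seq (Assign 8 (Bin Mod (Reg 4) (Reg 9)))
       (Seq (Assign 4 (Bin Div (Reg 4) (Reg 9)))
         (Cond (Bin And (Bin Equal (Reg 4) (Lit 1)) (Bin Less stack_base (Reg 5)))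
            (Seq (Assign 5 (Bin Sub (Reg 5) (Lit 1)))
              (Load 4 (Reg 5)))
            Skip))"

definition lookup_com :: com where
  "lookup_com = Load 7 (Bin Div (Reg 6) Word_Length)"

definition discovered_exp :: exp where
  "discovered_exp = Bin And (Bin Shr (Reg 7) (Bin Mod (Reg 6) Word_Length)) (Lit 1)"

definition discover_com :: com where
  "discover_com =
     Seq (Store (Bin Div (Reg 6) Word_Length)
            (Bin Or (Reg 7) (Bin Shl (Lit 1) (Bin Mod (Reg 6) Word_Length))))
       (Seq (Output (Lit 0))
         (Seq (Output (Reg 6))
           (Seq (Assign 2 (Reg 6))
             (Assign 3 (Lit 0)))))"

definition descend_com :: com where
  "descend_com =
     Seq (Assign 8 (Reg 3))
       (Seq (Assign 9 (Out_Degree (Reg 2)))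
         (Seq push_com
           (Seq (Assign 8 (Cross_Pointer (Reg 2) (Reg 3)))
             (Seq (Assign 9 (In_Degree (Reg 6)))
               (Seq push_com discover_com)))))"

definition return_com :: com where
  "return_com =
     Seq (Assign 9 (In_Degree (Reg 2)))
       (Seq pop_com
         (Seq (Assign 2 (In_Neighbour (Reg 2) (Reg 8)))
           (Seq (Assign 9 (Out_Degree (Reg 2)))
             (Seq pop_com
               (Assign 3 (Bin Add (Reg 8) (Lit 1)))))))"

text \<open>Register 0 advances only past a discovered vertex. It therefore holds the root as long
  as the tree of that root is searched, and \<open>finish_com\<close> recognises the end of the tree
  by comparing with it.\<close>

definition root_com :: com where
  "root_com =
     Seq (Assign 6 (Reg 0))
       (Seq lookup_com
         (Cond discovered_exp
            (Assign 0 (Bin Add (Reg 0) (Lit 1)))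
            (Seq discover_com (Assign 1 (Lit 1)))))"

definition scan_com :: com where
  "scan_com =
     Seq (Assign 6 (Out_Neighbour (Reg 2) (Reg 3)))
       (Seq lookup_com
         (Cond discovered_exp
            (Assign 3 (Bin Add (Reg 3) (Lit 1)))
            descend_com))"

definition finish_com :: com where
  "finish_com =
     Seq (Output (Lit 1))
       (Seq (Output (Reg 2))
         (Cond (Bin Equal (Reg 2) (Reg 0)) (Assign 1 (Lit 0)) return_com))"

definition step_com :: com where
  "step_com =
     Cond (Reg 1)
       (Cond (Bin Less (Reg 3) (Out_Degree (Reg 2))) scan_com finish_com)
       root_com"

definition step_guard :: exp where
  "step_guard = Bin Less (Reg 0) Num_Vertices"

definition init_com :: com where
  "init_com = Seq (Assign 5 stack_base) (Assign 4 (Lit 1))"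

definition dfs_com :: com where
  "dfs_com = Seq init_com (While step_guard step_com)"

definition step_time :: nat where
  "step_time = 1 + exp_nodes step_guard + com_nodes step_com"

text \<open>The factor 4 comes from the initial potential \<open>3 * n + a\<close>, increased by 1
  for the final test of the guard.\<close>

definition dfs_time :: nat where
  "dfs_time = 4 * step_time + 1 + com_nodes init_com"

section \<open>Correctness\<close>

text \<open>The induction step uses \<open>(e + 1) ^ 2 <= 2 * e ^ 2\<close> for
  \<open>e >= 3\<close>. The 1 added to the exponent covers \<open>d = 3\<close>, where
  \<open>9 > 2 ^ 3\<close>.\<close>

lemma square_le_power2: "d ^ 2 \<le> 2 ^ (d + 1)" for d :: nat
proof (induction d rule: less_induct)
  case (less d)
  show ?case
  proof (cases "d \<le> 3")
    case True
    then have "d = 0 \<or> d = 1 \<or> d = 2 \<or> d = 3" by arith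
    then show ?thesis by auto
  next
    case False
    then obtain e where e: "d = Suc e" "3 \<le> e" by (cases d) auto
    have "3 * e \<le> e * e" using e(2) by (rule mult_le_mono1)
    then have "1 + 2 * e \<le> e * e" using e(2) by linarith
    then have "d ^ 2 \<le> 2 * e ^ 2"
      using e by (simp add: power2_eq_square)
    also have "\<dots> \<le> 2 ^ (d + 1)"
      using less[of e] e by simp
    finally show ?thesis .
  qed
qed

text \<open>The size bound counts arcs, so that undirected graphs are covered too. The factor 4
  makes vertices, addresses up to \<open>M\<close> and twice any degree fit into a word;
  \<open>3 <= w\<close> gives \<open>w - 1 >= 2\<close> and hence at most \<open>n + a\<close> full
  words.\<close>

locale dfs_input =
  fixes G :: "nat pair_pre_digraph" and I :: adjacency and w :: nat
  assumes fin: "pair_fin_digraph G"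
    and stores: "stores_digraph I G"
    and nonempty: "pverts G \<noteq> {}"
    and word_length: "3 \<le> w" "4 * (card (pverts G) + card (parcs G)) \<le> 2 ^ w"
begin

abbreviation n :: nat where "n \<equiv> num_vertices I"
abbreviation a :: nat where "a \<equiv> card (parcs G)"
abbreviation outdeg :: "nat \<Rightarrow> nat" where "outdeg v \<equiv> length (out_list I v)"
abbreviation indeg :: "nat \<Rightarrow> nat" where "indeg v \<equiv> length (in_list I v)"
abbreviation base :: nat where "base \<equiv> n div w + 1"
abbreviation stack_words :: nat where "stack_words \<equiv> (2 * a + 2 * n) div (w - 1)"

text \<open>Only the bitmap and the full words of the stack lie in memory; the word being filled is
  kept in register 4.\<close>

definition M :: nat where "M = base + stack_words"

section \<open>Degree sums and values that fit into a word\<close>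

lemma pverts_eq: "pverts G = {..<n}"
  using stores by (simp add: stores_digraph_def)

lemma n_pos: "0 < n"
  using nonempty by (auto simp: pverts_eq)

lemma large: "4 * (n + a) \<le> 2 ^ w"
  using word_length(2) by (simp add: pverts_eq)

lemma arc_verts: "(u, v) \<in> parcs G \<Longrightarrow> u < n \<and> v < n"
proof -
  interpret pair_fin_digraph G by (rule fin)
  show "(u, v) \<in> parcs G \<Longrightarrow> u < n \<and> v < n"
    using arc_fst_in_verts arc_snd_in_verts pverts_eq by fastforce
qed

lemma lists:
  assumes "v < n"
  shows "distinct (out_list I v)" "set (out_list I v) = {u. (v, u) \<in> parcs G}"
    "distinct (in_list I v)" "set (in_list I v) = {u. (u, v) \<in> parcs G}"
  using stores assms by (auto simp: stores_digraph_def)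

lemma out_list_nth:
  assumes "u < n" "i < outdeg u"
  shows "(u, out_list I u ! i) \<in> parcs G" "out_list I u ! i < n"
proof -
  show "(u, out_list I u ! i) \<in> parcs G"
    using lists(2)[OF assms(1)] nth_mem[OF assms(2)] by auto
  then show "out_list I u ! i < n"
    using arc_verts by blast
qed

lemma cross:
  assumes "u < n" "i < outdeg u"
  shows "cross_pointer I u i < indeg (out_list I u ! i)"
    "in_list I (out_list I u ! i) ! cross_pointer I u i = u"
  using stores assms unfolding stores_digraph_def by (auto simp: Let_def)

lemma sum_outdeg: "(\<Sum>v<n. outdeg v) = a"
proof -
  have "parcs G = Sigma {..<n} (\<lambda>v. set (out_list I v))"
    using arc_verts by (auto simp: lists)
  then have "a = (\<Sum>v<n. card (set (out_list I v)))"
    by (simp add: card_SigmaI)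
  then show ?thesis
    by (simp add: distinct_card lists(1))
qed

lemma sum_indeg: "(\<Sum>v<n. indeg v) = a"
proof -
  have "(\<lambda>(u, v). (v, u)) ` parcs G = Sigma {..<n} (\<lambda>v. set (in_list I v))"
    using arc_verts by (auto simp: lists image_iff)
  moreover have "card ((\<lambda>(u, v). (v, u)) ` parcs G) = a"
    by (intro card_image) (auto simp: inj_on_def)
  ultimately have "a = (\<Sum>v<n. card (set (in_list I v)))"
    by (simp add: card_SigmaI)
  then show ?thesis
    by (simp add: distinct_card lists(3))
qed

lemma degree_le:
  assumes "v < n"
  shows "outdeg v \<le> a" "indeg v \<le> a"
  using member_le_sum[of v "{..<n}" outdeg] member_le_sum[of v "{..<n}" indeg] assms
  by (simp_all add: sum_outdeg sum_indeg)

lemma M_less: "M < 2 ^ w"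
proof -
  have "n div w \<le> n" by simp
  moreover have "stack_words \<le> (2 * a + 2 * n) div 2"
    using word_length(1) by (intro div_le_mono2) auto
  moreover have "(2 * a + 2 * n) div 2 = a + n" by simp
  ultimately have "M \<le> n + 1 + (a + n)" unfolding M_def by linarith
  also have "\<dots> < 4 * (n + a)"
    using n_pos by simp
  finally show ?thesis
    using large by (rule less_le_trans)
qed

lemma w_pos [simp]: "0 < w"
  using word_length(1) by simp

text \<open>As rewrite rules these remove the reductions modulo \<open>2 ^ w\<close> from the
  evaluation of vertices, list positions, degrees and addresses.\<close>

lemma take_bit_small [simp]:
  "x \<le> n \<Longrightarrow> take_bit w x = x"
  "x \<le> a \<Longrightarrow> take_bit w x = x"
  "x \<le> Suc a \<Longrightarrow> take_bit w x = x"
  "x \<le> M \<Longrightarrow> take_bit w x = x"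
  "take_bit w w = w"
  "take_bit w 1 = (1::nat)"
  "take_bit w (Suc 0) = Suc 0"
  "take_bit w (of_bool b) = (of_bool b :: nat)"
  using large M_less less_exp[of w] n_pos word_length(1)
  by (auto intro!: take_bit_nat_eq_self simp: one_less_power)

section \<open>Operations on the packed stack and the bitmap\<close>

definition packed_stack :: "state \<Rightarrow> (nat \<times> nat) list \<Rightarrow> bool" where
  "packed_stack s items \<longleftrightarrow>
     (\<forall>item\<in>set items. valid_item w item) \<and> length (snd (packed w items)) \<le> stack_words \<and>
     regs s 4 = fst (packed w items) \<and> regs s 5 = base + length (snd (packed w items)) \<and>
     stack_in_memory (memory s) base (snd (packed w items))"

definition bitmap :: "state \<Rightarrow> nat set \<Rightarrow> bool" where
  "bitmap s V \<longleftrightarrow> (\<forall>x<n. bit (memory s (x div w)) (x mod w) \<longleftrightarrow> x \<in> V)"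

lemma bitmap_cong:
  assumes "bitmap s V" "\<And>p. p < base \<Longrightarrow> memory s' p = memory s p"
  shows "bitmap s' V"
  using assms by (simp add: bitmap_def div_le_mono le_imp_less_Suc)

text \<open>The length hypothesis concerns the stack after the push: on overflow it puts the address
  \<open>base + length ws\<close> of the stored word below \<open>M\<close>.\<close>

lemma run_push:
  assumes st: "packed_stack s items" and item: "valid_item w (x, d)"
    and regs: "regs s 8 = x" "regs s 9 = d"
    and len: "length (snd (packed w ((x, d) # items))) \<le> stack_words"
  shows "\<exists>s'. run w M I push_com s = Some s' \<and> packed_stack s' ((x, d) # items) \<and>
    (\<forall>r. r \<noteq> 4 \<longrightarrow> r \<noteq> 5 \<longrightarrow> regs s' r = regs s r) \<and>
    (\<forall>p<base. memory s' p = memory s p) \<and> output_tape s' = output_tape s"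
proof -
  obtain cur ws where p: "packed w items = (cur, ws)" by force
  have xd: "x < d" "2 * d \<le> 2 ^ w"
    using item by (auto simp: valid_item_def)
  have b: "1 \<le> cur" "cur < 2 ^ w"
    using packed_bounds[OF _ _ p] st word_length(1) by (auto simp: packed_stack_def)
  have r: "regs s 4 = cur" "regs s 5 = base + length ws" "stack_in_memory (memory s) base ws"
    "length ws \<le> stack_words"
    using st by (auto simp: packed_stack_def p)
  have [simp]: "take_bit w d = d" "take_bit w x = x" "take_bit w cur = cur"
      "take_bit w (2 ^ w - d) = 2 ^ w - d"
      "take_bit w ((2 ^ w - d) div d) = (2 ^ w - d) div d"
    using xd b by (auto intro!: take_bit_nat_eq_self intro: le_less_trans[OF div_le_dividend])
  show ?thesis
  proof (cases "(2 ^ w - d) div d < cur")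
    case True
    have l: "Suc (length ws) \<le> stack_words"
      using len True by (simp add: p)
    have [simp]: "take_bit w (base + length ws) = base + length ws"
       "take_bit w (Suc (base + length ws)) = Suc (base + length ws)"
       "take_bit w (d + x) = d + x"
      using l xd by (auto simp: M_def intro: take_bit_nat_eq_self simp del: take_bit_Suc)
    show ?thesis
      using st item xd l True
      using word_length(1)
      by (auto simp: M_def push_com_def regs r packed_stack_def p stack_in_memory_update_above)
  next
    case False
    have [simp]: "take_bit w (cur * d) = cur * d" "take_bit w (cur * d + x) = cur * d + x"
      using no_overflow[of cur "2 ^ w" d x] False xd by (auto intro!: take_bit_nat_eq_self)
    show ?thesis
      using st item xd False len
      by (auto simp: M_def push_com_def regs r packed_stack_def p)
  qed
qed

text \<open>If the push overflowed, the current word is \<open>d + x\<close> with quotient 1, and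
  the older word is reloaded. Otherwise the quotient is the older word itself, which is 1 only if no
  full words exist, by \<open>packed_bounds\<close>.\<close>

lemma run_pop:
  assumes st: "packed_stack s ((x, d) # items)" and regs: "regs s 9 = d"
  shows "\<exists>s'. run w M I pop_com s = Some s' \<and> packed_stack s' items \<and> regs s' 8 = x \<and>
    (\<forall>r. r \<noteq> 4 \<longrightarrow> r \<noteq> 5 \<longrightarrow> r \<noteq> 8 \<longrightarrow> regs s' r = regs s r) \<and>
    memory s' = memory s \<and> output_tape s' = output_tape s"
proof -
  obtain cur ws where p: "packed w items = (cur, ws)" by force
  have xd: "x < d" "2 * d \<le> 2 ^ w" and valid: "\<forall>item\<in>set items. valid_item w item"
    using st by (auto simp: valid_item_def packed_stack_def)
  have b: "1 \<le> cur" "cur < 2 ^ w" "ws \<noteq> [] \<longrightarrow> 2 \<le> cur"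
    using packed_bounds[OF valid _ p] word_length(1) by auto
  have [simp]: "take_bit w d = d" "take_bit w x = x" "take_bit w cur = cur" "take_bit w 0 = (0::nat)"
    using xd b by (auto intro!: take_bit_nat_eq_self)
  show ?thesis
  proof (cases "(2 ^ w - d) div d < cur")
    case True
    have r: "regs s 4 = d + x" "regs s 5 = Suc (base + length ws)"
      "memory s (base + length ws) = cur" "stack_in_memory (memory s) base ws"
      "Suc (length ws) \<le> stack_words"
      using st True by (auto simp: packed_stack_def p)
    have [simp]: "take_bit w (base + length ws) = base + length ws"
       "take_bit w (Suc (base + length ws)) = Suc (base + length ws)"
       "take_bit w (d + x) = d + x"
      using r(5) xd by (auto simp: M_def intro: take_bit_nat_eq_self simp del: take_bit_Suc)
    \<comment> \<open>Decrementing the address is computed as \<open>2 ^ w + address - 1\<close>;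
      the reduction modulo \<open>2 ^ w\<close> removes the first summand.\<close>
    have "take_bit w (base + length ws + 2 ^ w) = take_bit w (base + length ws)"
      unfolding take_bit_eq_mod by (rule mod_add_self2)
    then have [simp]: "take_bit w (Suc (2 ^ w + (n div w + length ws))) = Suc (n div w + length ws)"
      using take_bit_small(4)[of "base + length ws"] r(5) by (simp add: M_def ac_simps)
    show ?thesis
      using st xd valid True word_length(1) r(3-5)
      by (auto simp: M_def pop_com_def regs r(1,2) packed_stack_def p)
  next
    case False
    have r: "regs s 4 = cur * d + x" "regs s 5 = base + length ws"
      "stack_in_memory (memory s) base ws" "length ws \<le> stack_words"
      using st False by (auto simp: packed_stack_def p)
    have [simp]: "take_bit w (cur * d + x) = cur * d + x"
      using no_overflow[of cur "2 ^ w" d x] False xd by (auto intro!: take_bit_nat_eq_self)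
    have [simp]: "take_bit w (base + length ws) = base + length ws"
      using r(4) by (simp add: M_def)
    show ?thesis
      using st xd valid False word_length(1) r(3,4) b
      by (auto simp: M_def pop_com_def regs r(1,2) packed_stack_def p)
  qed
qed

lemma run_lookup:
  assumes "regs s 6 = v" "v < n"
  shows "run w M I lookup_com s = Some (s\<lparr>regs := (regs s)(7 := memory s (v div w))\<rparr>)"
proof -
  have "v div w < M" "v div w \<le> n"
    using assms(2) div_le_mono[of v n w] div_le_dividend[of v w] unfolding M_def by linarith+
  then show ?thesis
    using assms by (simp add: lookup_com_def)
qed

lemma eval_discovered:
  assumes "regs r 6 = v" "regs r 7 = memory r (v div w)" "v < n" "bitmap r V"
  shows "eval w I (regs r) discovered_exp \<noteq> 0 \<longleftrightarrow> v \<in> V"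
proof -
  have "v mod w < w" using word_length(1) by simp
  moreover have "take_bit w (v mod w) = v mod w"
    using calculation less_exp[of w] by (intro take_bit_nat_eq_self) linarith
  moreover have "odd (take_bit w (drop_bit (v mod w) (take_bit w (memory r (v div w))))) \<longleftrightarrow>
      bit (memory r (v div w)) (v mod w)"
    using calculation(1) by (simp add: bit_simps flip: bit_0)
  ultimately have "eval w I (regs r) discovered_exp \<noteq> 0 \<longleftrightarrow> bit (memory r (v div w)) (v mod w)"
    using assms(1-3) by (simp add: discovered_exp_def and_one_eq mod_2_eq_odd)
  then show ?thesis
    using assms(3,4) by (simp add: bitmap_def)
qed

lemma run_discover:
  assumes regs: "regs s 6 = v" "regs s 7 = memory s (v div w)" "v < n"
    and V: "bitmap s V" and st: "packed_stack s items"
  shows "\<exists>s'. run w M I discover_com s = Some s' \<and> packed_stack s' items \<and> bitmap s' (insert v V) \<and>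
    regs s' = (regs s)(2 := v, 3 := 0) \<and>
    output_tape s' = output_tape s @ encode_event (Discover v)"
proof -
  have "v mod w < w" using word_length(1) by simp
  then have [simp]: "take_bit w (v mod w) = v mod w"
    using less_exp[of w] by (intro take_bit_nat_eq_self) linarith
  have addr: "v div w < base" "v div w \<le> n"
    using assms(3) div_le_mono[of v n w] div_le_dividend[of v w] by linarith+
  then have lt: "v div w < M" unfolding M_def by linarith
  define c where "c = take_bit w (or (take_bit w (memory s (v div w))) (take_bit w (push_bit (v mod w) 1)))"
  have c: "bit c k \<longleftrightarrow> k = v mod w \<or> bit (memory s (v div w)) k" if "k < w" for k
    using that by (auto simp: c_def bit_simps)
  define s' where "s' = s\<lparr>regs := (regs s)(2 := v, 3 := 0),
    memory := (memory s)(v div w := c),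
    output_tape := output_tape s @ encode_event (Discover v)\<rparr>"
  have "run w M I discover_com s = Some s'"
    using regs addr lt by (simp add: discover_com_def s'_def c_def)
  moreover have "packed_stack s' items"
    using st addr by (simp add: packed_stack_def s'_def stack_in_memory_update_below)
  moreover have "bitmap s' (insert v V)"
    unfolding bitmap_def
  proof (intro allI impI)
    fix x assume x: "x < n"
    have "x mod w < w" using word_length(1) by simp
    \<comment> \<open>A vertex is determined by its word and its bit position, so setting this bit
      affects \<open>v\<close> only.\<close>
    moreover have "x = v \<longleftrightarrow> x div w = v div w \<and> x mod w = v mod w"
      by (metis div_mult_mod_eq)
    ultimately show "bit (memory s' (x div w)) (x mod w) \<longleftrightarrow> x \<in> insert v V"
      using V x c[of "x mod w"] by (auto simp: bitmap_def s'_def)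
  qed
  ultimately show ?thesis
    by (auto simp: s'_def)
qed

text \<open>
  A frame \<open>(v, i)\<close> is a vertex on the stack of the search with a position in its out-list: the
  next one to be scanned for the topmost frame, and that of the child for the others. The packed
  stack omits the vertices, since the topmost vertex and the items determine them.
\<close>

fun frame_items :: "nat \<Rightarrow> (nat \<times> nat) list \<Rightarrow> (nat \<times> nat) list" where
  "frame_items v [] = []"
| "frame_items v ((u, j) # fs) =
     (cross_pointer I u j, indeg v) # (j, outdeg u) # frame_items u fs"

fun linked :: "nat \<Rightarrow> (nat \<times> nat) list \<Rightarrow> bool" where
  "linked v [] = True"
| "linked v ((u, j) # fs) = (j < outdeg u \<and> out_list I u ! j = v \<and> linked u fs)"

text \<open>The clause on \<open>k < j\<close> turns into the premise of
  \<open>dfs_from.backtrack\<close> once \<open>j\<close> reaches the end of the list. Distinctness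
  lets every degree occur at most once as a radix and makes the bottom frame the only one with
  vertex \<open>r\<close>.\<close>

definition frames :: "nat set \<Rightarrow> nat \<Rightarrow> (nat \<times> nat) list \<Rightarrow> bool" where
  "frames V r fs \<longleftrightarrow>
     distinct (map fst fs) \<and>
     (\<forall>(v, j)\<in>set fs. v \<in> V \<and> j \<le> outdeg v \<and> (\<forall>k<j. out_list I v ! k \<in> V)) \<and>
     (fs \<noteq> [] \<longrightarrow> linked (fst (hd fs)) (tl fs) \<and> fst (last fs) = r)"

text \<open>All candidates below \<open>r\<close> are discovered, so the traversal has discovered
  every vertex when \<open>r\<close> reaches \<open>n\<close>.\<close>

definition represents :: "state \<Rightarrow> nat set \<Rightarrow> nat \<Rightarrow> (nat \<times> nat) list \<Rightarrow> bool" where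
  "represents s V r fs \<longleftrightarrow>
     V \<subseteq> {..<n} \<and> r \<le> n \<and> {..<r} \<subseteq> V \<and> frames V r fs \<and> bitmap s V \<and> regs s 0 = r \<and>
     (case fs of
        [] \<Rightarrow> regs s 1 = 0 \<and> packed_stack s []
      | (u, i) # fs' \<Rightarrow>
          regs s 1 = 1 \<and> regs s 2 = u \<and> regs s 3 = i \<and> packed_stack s (frame_items u fs'))"

text \<open>This bounds the remaining iterations. Discovery trades \<open>outdeg v + 2\<close> for a
  frame of weight \<open>outdeg v + 1\<close>; each scan of a discovered neighbour lowers the weight
  of the frame by 1, and the last unit pays for finishing.\<close>

definition potential :: "nat set \<Rightarrow> nat \<Rightarrow> (nat \<times> nat) list \<Rightarrow> nat" where
  "potential V r fs =
     (n - r) + (\<Sum>v\<in>{..<n} - V. outdeg v + 2) + (\<Sum>(v, j)\<leftarrow>fs. outdeg v - j + 1)"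

lemma potential_discover:
  assumes "v < n" "v \<notin> V"
  shows "potential (insert v V) r ((v, 0) # fs) < potential V r fs"
proof -
  have "(\<Sum>v\<in>{..<n} - V. outdeg v + 2) =
      outdeg v + 2 + (\<Sum>v\<in>{..<n} - V - {v}. outdeg v + 2)"
    using assms by (intro sum.remove) auto
  moreover have "{..<n} - V - {v} = {..<n} - insert v V" by blast
  ultimately show ?thesis
    by (simp add: potential_def)
qed

section \<open>The number of full words on the stack\<close>

lemma frame_items_valid:
  assumes "linked v fs" "v < n" "\<forall>u\<in>fst ` set fs. u < n"
  shows "\<forall>item\<in>set (frame_items v fs). valid_item w item"
  using assms
proof (induction v fs rule: frame_items.induct)
  case (2 v u j fs)
  have "2 * k \<le> 2 ^ w" if "k \<le> a" for k
    using that large by simp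
  then have "valid_item w (j, outdeg u)" "valid_item w (cross_pointer I u j, indeg v)"
    using 2 cross[of u j] degree_le by (auto simp: valid_item_def)
  then show ?case
    using 2 by auto
qed simp

text \<open>The extra factor on the left strengthens the induction: the out-degree of the top vertex
  becomes a radix once another frame is put on it. Taking \<open>max 1\<close> covers vertices of
  degree 0.\<close>

lemma frame_items_product:
  assumes "linked v fs"
  shows "prod_list (map snd (frame_items v fs)) * max 1 (outdeg v) \<le>
    (\<Prod>u\<leftarrow>v # map fst fs. max 1 (indeg u) * max 1 (outdeg u))"
  using assms
proof (induction v fs rule: frame_items.induct)
  case (1 v)
  show ?case
    using mult_le_mono1[of 1 "max 1 (indeg v)" "max 1 (outdeg v)"] by simp
next
  case (2 v u j fs)
  let ?p = "prod_list (map snd (frame_items u fs))"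
  have "indeg v * (outdeg u * ?p) * max 1 (outdeg v) =
      indeg v * max 1 (outdeg v) * (?p * outdeg u)"
    by (simp only: ac_simps)
  also have "\<dots> \<le> max 1 (indeg v) * max 1 (outdeg v) * (?p * max 1 (outdeg u))"
    by (intro mult_le_mono) auto
  also have "\<dots> \<le> max 1 (indeg v) * max 1 (outdeg v) *
      (\<Prod>u\<leftarrow>u # map fst fs. max 1 (indeg u) * max 1 (outdeg u))"
    using 2 by (intro mult_le_mono2) auto
  finally show ?case
    by simp
qed

lemma stack_words_suffice:
  assumes "linked v fs" "distinct (v # map fst fs)" "\<forall>u\<in>set (v # map fst fs). u < n"
  shows "length (snd (packed w (frame_items v fs))) \<le> stack_words"
proof -
  obtain cur ws where p: "packed w (frame_items v fs) = (cur, ws)" by force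
  let ?f = "\<lambda>u. max 1 (indeg u) * max 1 (outdeg u)"
  define Q where "Q = prod_list (map snd (frame_items v fs))"
  have "Q \<le> Q * max 1 (outdeg v)" by simp
  also have "\<dots> \<le> (\<Prod>u\<leftarrow>v # map fst fs. ?f u)"
    unfolding Q_def by (rule frame_items_product[OF assms(1)])
  also have "\<dots> = prod ?f (set (v # map fst fs))"
    by (rule prod.distinct_set_conv_list[OF assms(2), symmetric])
  \<comment> \<open>The factors of the vertices outside the stack are positive, so the product may
    be extended to all vertices, where the degree sums are known.\<close>
  also have "\<dots> \<le> prod ?f {..<n}"
  proof (rule dvd_imp_le)
    show "prod ?f (set (v # map fst fs)) dvd prod ?f {..<n}"
      using assms(3) by (intro prod_dvd_prod_subset) blast+
  qed (auto simp: less_max_iff_disj intro!: prod_pos)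
  finally have "Q ^ 2 \<le> prod ?f {..<n} ^ 2"
    by (rule power_mono) simp
  also have "\<dots> = (\<Prod>u<n. ?f u ^ 2)"
    by (rule prod_power_distrib)
  also have "\<dots> \<le> (\<Prod>u<n. 2 ^ (indeg u + outdeg u + 2))"
  proof (rule prod_mono)
    fix u
    have le: "max 1 d ^ 2 \<le> 2 ^ (d + 1)" for d :: nat
      using square_le_power2[of d] by (auto simp: max_def)
    have "?f u ^ 2 \<le> 2 ^ (indeg u + 1) * 2 ^ (outdeg u + 1)"
      unfolding power_mult_distrib by (intro mult_le_mono le)
    then show "0 \<le> ?f u ^ 2 \<and> ?f u ^ 2 \<le> 2 ^ (indeg u + outdeg u + 2)"
      by (simp add: power_add ac_simps)
  qed
  also have "\<dots> = 2 ^ (\<Sum>u<n. indeg u + outdeg u + 2)"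
    by (rule power_sum[symmetric])
  also have "(\<Sum>u<n. indeg u + outdeg u + 2) = 2 * a + 2 * n"
    by (simp add: sum.distrib sum_indeg sum_outdeg del: add_2_eq_Suc')
  finally have Q: "Q ^ 2 \<le> 2 ^ (2 * a + 2 * n)" .
  have b: "1 \<le> cur" "2 ^ ((w - 1) * length ws) * (cur + 1) \<le> 2 * Q ^ 2"
    using packed_bounds[OF frame_items_valid[OF assms(1)] _ p] assms(3) word_length(1)
    by (auto simp: Q_def)
  \<comment> \<open>Since \<open>cur + 1 >= 2\<close>, the factor 2 of \<open>packed_bounds\<close>
    cancels.\<close>
  have "2 ^ ((w - 1) * length ws) * 2 \<le> 2 ^ ((w - 1) * length ws) * (cur + 1)"
    using b(1) by (intro mult_le_mono2) simp
  then have "(2::nat) ^ ((w - 1) * length ws) \<le> 2 ^ (2 * a + 2 * n)"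
    using b(2) Q by linarith
  then have "(w - 1) * length ws \<le> 2 * a + 2 * n"
    by simp
  then show ?thesis
    using word_length(1) by (simp add: p less_eq_div_iff_mult_less_eq mult.commute)
qed

text \<open>Descending pushes two items; the bound for the stack after both thus also covers the
  state in between.\<close>

lemma length_packed_Cons: "length (snd (packed w items)) \<le> length (snd (packed w (item # items)))"
  by (cases item; cases "packed w items") simp

section \<open>Simulation of the steps of the search\<close>

lemma frames_vertices:
  assumes "frames V r fs" "V \<subseteq> {..<n}" "v \<in> fst ` set fs"
  shows "v \<in> V" "v < n"
  using assms by (auto simp: frames_def)

text \<open>The last clause runs backwards, as \<open>dfs_from\<close> describes continuations: one
  from the new configuration extends to one from the old. The list \<open>evs\<close> is empty when
  a discovered neighbour or root candidate is skipped.\<close>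

definition simulates_step ::
  "state \<Rightarrow> nat set \<Rightarrow> nat \<Rightarrow> (nat \<times> nat) list \<Rightarrow> com \<Rightarrow> bool" where
  "simulates_step s V r fs c \<longleftrightarrow>
     (\<exists>s' V' r' fs' evs.
        run w M I c s = Some s' \<and> represents s' V' r' fs' \<and>
        potential V' r' fs' < potential V r fs \<and>
        output_tape s' = output_tape s @ concat (map encode_event evs) \<and>
        (\<forall>es. dfs_from G (map fst fs') V' es \<longrightarrow> dfs_from G (map fst fs) V (evs @ es)))"

lemma simulates_root:
  assumes "represents s V r []" "r < n"
  shows "simulates_step s V r [] root_com"
proof -
  have R: "V \<subseteq> {..<n}" "{..<r} \<subseteq> V" "bitmap s V" "regs s 0 = r" "regs s 1 = 0" "packed_stack s []"
    using assms(1) by (auto simp: represents_def)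
  define s1 where "s1 = s\<lparr>regs := (regs s)(6 := r, 7 := memory s (r div w))\<rparr>"
  have s1: "bitmap s1 V" "packed_stack s1 []" "regs s1 6 = r" "regs s1 7 = memory s1 (r div w)"
    "regs s1 0 = r" "regs s1 1 = 0" "output_tape s1 = output_tape s"
    using R by (auto simp: s1_def bitmap_def packed_stack_def)
  have run1: "run w M I root_com s =
      run w M I (Cond discovered_exp (Assign 0 (Bin Add (Reg 0) (Lit 1)))
            (Seq discover_com (Assign 1 (Lit 1)))) s1"
    using assms(2) R by (simp add: root_com_def run_lookup[where v = r] s1_def)
  note test = eval_discovered[OF s1(3,4) assms(2) s1(1)]
  show ?thesis
  proof (cases "r \<in> V")
    case True
    define s2 where "s2 = s1\<lparr>regs := (regs s1)(0 := r + 1)\<rparr>"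
    have "run w M I root_com s = Some s2"
      using run1 test True s1 assms(2) word_length(1) by (simp add: s2_def)
    moreover have "represents s2 V (r + 1) []"
      using s1 True R assms(2)
      by (auto simp: s2_def represents_def bitmap_def packed_stack_def frames_def lessThan_Suc)
    moreover have "potential V (r + 1) [] < potential V r []"
      using assms(2) by (simp add: potential_def)
    ultimately show ?thesis
      unfolding simulates_step_def using s1
      by (intro exI[of _ s2] exI[of _ V] exI[of _ "r + 1"] exI[of _ "[]"]) (simp add: s2_def)
  next
    case False
    obtain s2 where s2: "run w M I discover_com s1 = Some s2" "packed_stack s2 []"
        "bitmap s2 (insert r V)" "regs s2 = (regs s1)(2 := r, 3 := 0)"
        "output_tape s2 = output_tape s1 @ encode_event (Discover r)"
      using run_discover[OF s1(3,4) assms(2) s1(1,2)] by blast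
    define s3 where "s3 = s2\<lparr>regs := (regs s2)(1 := 1)\<rparr>"
    have "run w M I root_com s = Some s3"
      using run1 test False s2 by (simp add: s3_def)
    moreover have "represents s3 (insert r V) r [(r, 0)]"
      using s2 s1 R assms(2)
      by (auto simp: s3_def represents_def bitmap_def packed_stack_def frames_def)
    moreover have "potential (insert r V) r [(r, 0)] < potential V r []"
      using assms(2) False by (rule potential_discover)
    moreover have "dfs_from G [] V ([Discover r] @ es)" if "dfs_from G [r] (insert r V) es" for es
      using that False assms(2) by (simp add: dfs_from.root pverts_eq)
    ultimately show ?thesis
      unfolding simulates_step_def using s1 s2
      by (intro exI[of _ s3] exI[of _ "insert r V"] exI[of _ r] exI[of _ "[(r, 0)]"]
          exI[of _ "[Discover r]"]) (simp add: s3_def)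
  qed
qed

lemma simulates_scan:
  assumes rep: "represents s V r ((u, i) # fs)" and i: "i < outdeg u"
  shows "simulates_step s V r ((u, i) # fs) scan_com"
proof -
  have R: "V \<subseteq> {..<n}" "{..<r} \<subseteq> V" "r \<le> n" "frames V r ((u, i) # fs)" "bitmap s V"
      "regs s 0 = r" "regs s 1 = 1" "regs s 2 = u" "regs s 3 = i"
      "packed_stack s (frame_items u fs)"
    using rep by (auto simp: represents_def)
  define v where "v = out_list I u ! i"
  have u: "u < n" "u \<in> V"
    using frames_vertices[OF R(4,1)] by auto
  have v: "v < n" "(u, v) \<in> parcs G"
    using out_list_nth[OF u(1) i] by (auto simp: v_def)
  have [simp]: "take_bit w u = u" "take_bit w i = i" "take_bit w (Suc i) = Suc i"
      "take_bit w v = v" "take_bit w r = r"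
    using u(1) v(1) i degree_le(1)[OF u(1)] R(3) by (simp_all del: take_bit_Suc)
  define s1 where "s1 = s\<lparr>regs := (regs s)(6 := v, 7 := memory s (v div w))\<rparr>"
  have s1: "bitmap s1 V" "packed_stack s1 (frame_items u fs)" "regs s1 6 = v"
    "regs s1 7 = memory s1 (v div w)" "regs s1 0 = r" "regs s1 1 = 1" "regs s1 2 = u" "regs s1 3 = i"
    "output_tape s1 = output_tape s"
    using R by (auto simp: s1_def bitmap_def packed_stack_def)
  have run1: "run w M I scan_com s =
      run w M I (Cond discovered_exp (Assign 3 (Bin Add (Reg 3) (Lit 1))) descend_com) s1"
    using v R i
    by (simp add: scan_com_def run_lookup[where v = v] s1_def list_entry_def flip: v_def)
  note test = eval_discovered[OF s1(3,4) v(1) s1(1)]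
  show ?thesis
  proof (cases "v \<in> V")
    case True
    define s2 where "s2 = s1\<lparr>regs := (regs s1)(3 := i + 1)\<rparr>"
    have "run w M I scan_com s = Some s2"
      using run1 test True s1 i word_length(1) by (simp add: s2_def)
    moreover have "frames V r ((u, i + 1) # fs)"
      using R(4) True i by (auto simp: frames_def v_def less_Suc_eq)
    then have "represents s2 V r ((u, i + 1) # fs)"
      using s1 R by (auto simp: s2_def represents_def bitmap_def packed_stack_def)
    moreover have "potential V r ((u, i + 1) # fs) < potential V r ((u, i) # fs)"
      using i by (simp add: potential_def)
    ultimately show ?thesis
      unfolding simulates_step_def using s1
      by (intro exI[of _ s2] exI[of _ V] exI[of _ r] exI[of _ "(u, i + 1) # fs"] exI[of _ "[]"])
        (simp add: s2_def)
  next
    case False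
    define items where "items = (i, outdeg u) # frame_items u fs"
    define fs' where "fs' = (v, 0::nat) # (u, i) # fs"
    \<comment> \<open>The future frames come first, because their linkage and distinctness yield the
      space bound for the pushes.\<close>
    have fr: "frames (insert v V) r fs'"
      using R(4) False i by (auto simp: frames_def v_def fs'_def)
    have all_items: "frame_items v ((u, i) # fs) = (cross_pointer I u i, indeg v) # items"
      by (simp add: items_def)
    have lk: "linked v ((u, i) # fs)"
      and vs: "distinct (v # map fst ((u, i) # fs))" "\<forall>x\<in>set (v # map fst ((u, i) # fs)). x < n"
      using fr frames_vertices[OF fr] R(1) v(1) by (auto simp: frames_def fs'_def)
    have valid: "valid_item w (i, outdeg u)" "valid_item w (cross_pointer I u i, indeg v)"
      using frame_items_valid[OF lk] vs(2) by auto
    have len: "length (snd (packed w ((cross_pointer I u i, indeg v) # items))) \<le> stack_words"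
      using stack_words_suffice[OF lk vs] by (simp add: items_def)
    then have len': "length (snd (packed w ((i, outdeg u) # frame_items u fs))) \<le> stack_words"
      using length_packed_Cons[of items] unfolding items_def by (rule order_trans[rotated])
    define s2 where "s2 = s1\<lparr>regs := (regs s1)(8 := i, 9 := outdeg u)\<rparr>"
    have "packed_stack s2 (frame_items u fs)" "regs s2 8 = i" "regs s2 9 = outdeg u"
      using s1 by (simp_all add: s2_def packed_stack_def)
    from run_push[OF this(1) valid(1) this(2,3) len'] obtain s3 where s3:
      "run w M I push_com s2 = Some s3" "packed_stack s3 items"
      "\<And>r. r \<noteq> 4 \<Longrightarrow> r \<noteq> 5 \<Longrightarrow> regs s3 r = regs s2 r" "\<forall>p<base. memory s3 p = memory s2 p"
      "output_tape s3 = output_tape s2"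
      by (auto simp: items_def)
    define s4 where "s4 = s3\<lparr>regs := (regs s3)(8 := cross_pointer I u i, 9 := indeg v)\<rparr>"
    have "packed_stack s4 items" "regs s4 8 = cross_pointer I u i" "regs s4 9 = indeg v"
      using s3(2) by (simp_all add: s4_def packed_stack_def)
    from run_push[OF this(1) valid(2) this(2,3) len] obtain s5 where s5:
      "run w M I push_com s4 = Some s5" "packed_stack s5 (frame_items v ((u, i) # fs))"
      "\<And>r. r \<noteq> 4 \<Longrightarrow> r \<noteq> 5 \<Longrightarrow> regs s5 r = regs s4 r" "\<forall>p<base. memory s5 p = memory s4 p"
      "output_tape s5 = output_tape s4"
      by (auto simp: items_def)
    \<comment> \<open>The pushes write only from \<open>base\<close> upwards. So the bitmap word
      loaded into register 7 beforehand is still current when \<open>discover_com\<close> writes it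
      back.\<close>
    have mem: "\<And>p. p < base \<Longrightarrow> memory s5 p = memory s p"
      using s3(4) s5(4) by (simp add: s4_def s2_def s1_def)
    have regs5: "regs s5 6 = v" "regs s5 7 = memory s5 (v div w)" "regs s5 0 = r" "regs s5 1 = 1"
      using s1 mem[of "v div w"] v(1)
      by (simp_all add: s5(3) s4_def s3(3) s2_def s1_def div_le_mono less_Suc_eq_le)
    obtain s6 where s6: "run w M I discover_com s5 = Some s6"
        "packed_stack s6 (frame_items v ((u, i) # fs))"
        "bitmap s6 (insert v V)" "regs s6 = (regs s5)(2 := v, 3 := 0)"
        "output_tape s6 = output_tape s5 @ encode_event (Discover v)"
      using run_discover[OF regs5(1,2) v(1) bitmap_cong[OF R(5) mem] s5(2)] by blast
    have [simp]: "take_bit w (outdeg u) = outdeg u" "take_bit w (indeg v) = indeg v"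
        "take_bit w (cross_pointer I u i) = cross_pointer I u i"
      using degree_le[OF u(1)] degree_le[OF v(1)] cross[OF u(1) i] by (simp_all add: v_def)
    have "run w M I descend_com s1 = Some s6"
      using s1 s3(1) s5(1) s6(1)
      by (simp add: descend_com_def s3(3) s2_def s4_def)
    then have "run w M I scan_com s = Some s6"
      using run1 test False by simp
    moreover have "represents s6 (insert v V) r fs'"
      using s6 regs5 R fr v(1) by (auto simp: represents_def fs'_def)
    moreover have "potential (insert v V) r fs' < potential V r ((u, i) # fs)"
      unfolding fs'_def using v(1) False by (rule potential_discover)
    moreover have "dfs_from G (map fst ((u, i) # fs)) V ([Discover v] @ es)"
      if "dfs_from G (map fst fs') (insert v V) es" for es
      using that False v(2) by (simp add: dfs_from.advance fs'_def)
    moreover have "output_tape s6 = output_tape s @ encode_event (Discover v)"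
      using s6(5) s5(5) s3(5) s1 by (simp add: s4_def s2_def)
    ultimately show ?thesis
      unfolding simulates_step_def
      by (intro exI[of _ s6] exI[of _ "insert v V"] exI[of _ r] exI[of _ fs']
          exI[of _ "[Discover v]"]) simp
  qed
qed

lemma simulates_finish:
  assumes rep: "represents s V r ((u, i) # fs)" and i: "\<not> i < outdeg u"
  shows "simulates_step s V r ((u, i) # fs) finish_com"
proof -
  have R: "V \<subseteq> {..<n}" "{..<r} \<subseteq> V" "r \<le> n" "frames V r ((u, i) # fs)" "bitmap s V"
      "regs s 0 = r" "regs s 1 = 1" "regs s 2 = u" "regs s 3 = i"
      "packed_stack s (frame_items u fs)"
    using rep by (auto simp: represents_def)
  have u: "u < n" "u \<in> V"
    using frames_vertices[OF R(4,1)] by auto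
  \<comment> \<open>Here \<open>i = outdeg u\<close>, so all positions of the out-list have been
    scanned.\<close>
  have nbrs: "v \<in> V" if arc: "(u, v) \<in> parcs G" for v
  proof -
    have "v \<in> set (out_list I u)"
      using lists(2)[OF u(1)] arc by simp
    then obtain k where "k < outdeg u" "out_list I u ! k = v"
      by (auto simp: in_set_conv_nth)
    then show ?thesis
      using R(4) i by (auto simp: frames_def)
  qed
  have backtrack: "dfs_from G (map fst ((u, i) # fs)) V ([Finish u] @ es)"
    if "dfs_from G (map fst fs) V es" for es
    using that nbrs by (simp add: dfs_from.backtrack)
  have [simp]: "take_bit w u = u" "take_bit w r = r" "take_bit w (indeg u) = indeg u"
      "take_bit w 0 = (0::nat)"
    using u(1) R(3) degree_le[OF u(1)] by simp_all
  define s1 where "s1 = s\<lparr>output_tape := output_tape s @ encode_event (Finish u)\<rparr>"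
  have run1: "run w M I finish_com s =
      run w M I (Cond (Bin Equal (Reg 2) (Reg 0)) (Assign 1 (Lit 0)) return_com) s1"
    using R by (simp add: finish_com_def s1_def)
  show ?thesis
  proof (cases fs)
    case Nil
    define s2 where "s2 = s1\<lparr>regs := (regs s1)(1 := 0)\<rparr>"
    have "u = r"
      using R(4) Nil by (simp add: frames_def)
    then have "run w M I finish_com s = Some s2"
      using run1 R by (simp add: s2_def s1_def)
    moreover have "represents s2 V r []"
      using R Nil
      by (auto simp: represents_def s2_def s1_def bitmap_def packed_stack_def frames_def)
    moreover have "potential V r [] < potential V r ((u, i) # fs)"
      by (simp add: potential_def Nil)
    ultimately show ?thesis
      unfolding simulates_step_def using backtrack Nil
      by (intro exI[of _ s2] exI[of _ V] exI[of _ r] exI[of _ "[]"] exI[of _ "[Finish u]"])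
        (simp add: s2_def s1_def)
  next
    case (Cons f fs1)
    obtain p j where f: "f = (p, j)" by force
    \<comment> \<open>The root \<open>r\<close> is the vertex of the bottom frame, so distinctness
      gives \<open>u \<noteq> r\<close> and the program takes the branch
      \<open>return_com\<close>.\<close>
    have fr: "frames V r ((p, j) # fs1)" and pj: "j < outdeg p" "out_list I p ! j = u" "u \<noteq> r"
      using R(4) Cons f by (auto simp: frames_def split: if_splits)
    have p: "p < n"
      using frames_vertices[OF fr R(1)] by auto
    have [simp]: "take_bit w p = p" "take_bit w j = j" "take_bit w (Suc j) = Suc j"
        "take_bit w (outdeg p) = outdeg p"
        "take_bit w (cross_pointer I p j) = cross_pointer I p j"
      using p pj degree_le[OF p] degree_le[OF u(1)] cross[OF p pj(1)]
      by (simp_all del: take_bit_Suc)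
    have nb: "in_list I u ! cross_pointer I p j = p" "cross_pointer I p j < indeg u"
      using cross[OF p pj(1)] pj by simp_all
    define s2 where "s2 = s1\<lparr>regs := (regs s1)(9 := indeg u)\<rparr>"
    have "packed_stack s2 ((cross_pointer I p j, indeg u) # (j, outdeg p) # frame_items p fs1)"
        "regs s2 9 = indeg u"
      using R(10) by (simp_all add: s2_def s1_def packed_stack_def Cons f)
    from run_pop[OF this] obtain s3 where s3:
      "run w M I pop_com s2 = Some s3" "packed_stack s3 ((j, outdeg p) # frame_items p fs1)"
      "regs s3 8 = cross_pointer I p j"
      "\<And>r. r \<noteq> 4 \<Longrightarrow> r \<noteq> 5 \<Longrightarrow> r \<noteq> 8 \<Longrightarrow> regs s3 r = regs s2 r"
      "memory s3 = memory s2" "output_tape s3 = output_tape s2"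
      by blast
    define s4 where "s4 = s3\<lparr>regs := (regs s3)(2 := p, 9 := outdeg p)\<rparr>"
    have "packed_stack s4 ((j, outdeg p) # frame_items p fs1)" "regs s4 9 = outdeg p"
      using s3(2) by (simp_all add: s4_def packed_stack_def)
    from run_pop[OF this] obtain s5 where s5:
      "run w M I pop_com s4 = Some s5" "packed_stack s5 (frame_items p fs1)" "regs s5 8 = j"
      "\<And>r. r \<noteq> 4 \<Longrightarrow> r \<noteq> 5 \<Longrightarrow> r \<noteq> 8 \<Longrightarrow> regs s5 r = regs s4 r"
      "memory s5 = memory s4" "output_tape s5 = output_tape s4"
      by blast
    define s6 where "s6 = s5\<lparr>regs := (regs s5)(3 := j + 1)\<rparr>"
    have "run w M I return_com s1 = Some s6"
      using R(8) s3(1) s5(1) s5(3) word_length(1) nb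
      by (simp add: return_com_def s1_def s2_def s3(3,4) s4_def s6_def list_entry_def)
    then have "run w M I finish_com s = Some s6"
      using run1 R pj(3) by (simp add: s1_def)
    \<comment> \<open>Position \<open>j\<close> of \<open>p\<close> holds the finished child
      \<open>u\<close>, which is discovered, so scanning resumes after it.\<close>
    moreover have "frames V r ((p, j + 1) # fs1)"
      using fr pj(1,2) u(2) by (auto simp: frames_def less_Suc_eq)
    then have "represents s6 V r ((p, j + 1) # fs1)"
      using R s5(2)
      by (auto simp: represents_def bitmap_def packed_stack_def s6_def s5(4,5) s4_def s3(4,5)
          s2_def s1_def)
    moreover have "potential V r ((p, j + 1) # fs1) < potential V r ((u, i) # fs)"
      by (simp add: potential_def Cons f)
    moreover have "output_tape s6 = output_tape s @ encode_event (Finish u)"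
      by (simp add: s6_def s5(6) s4_def s3(6) s2_def s1_def)
    ultimately show ?thesis
      unfolding simulates_step_def using backtrack Cons f
      by (intro exI[of _ s6] exI[of _ V] exI[of _ r] exI[of _ "(p, j + 1) # fs1"]
          exI[of _ "[Finish u]"]) simp
  qed
qed

lemma simulates_step_com:
  assumes rep: "represents s V r fs" and "r < n"
  shows "simulates_step s V r fs step_com"
proof (cases fs)
  case Nil
  then have "regs s 1 = 0"
    using rep by (simp add: represents_def)
  then have "run w M I step_com s = run w M I root_com s"
    by (simp add: step_com_def)
  then show ?thesis
    using simulates_root[of s V r] assms Nil by (simp add: simulates_step_def)
next
  case (Cons f fs1)
  obtain u i where f: "f = (u, i)" by force
  have R: "regs s 1 = 1" "regs s 2 = u" "regs s 3 = i" "frames V r ((u, i) # fs1)" "V \<subseteq> {..<n}"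
    using rep by (auto simp: represents_def Cons f)
  have u: "u < n"
    using frames_vertices[OF R(4,5)] by auto
  have "i \<le> outdeg u"
    using R(4) by (auto simp: frames_def)
  then have [simp]: "take_bit w u = u" "take_bit w i = i" "take_bit w (outdeg u) = outdeg u"
    using u degree_le(1)[OF u] by simp_all
  have "run w M I step_com s = run w M I (if i < outdeg u then scan_com else finish_com) s"
    using R word_length(1) by (simp add: step_com_def)
  then show ?thesis
    using simulates_scan[of s V r u i fs1] simulates_finish[of s V r u i fs1] rep
    by (simp add: simulates_step_def Cons f split: if_splits)
qed

section \<open>Total time and space\<close>

lemma exec_loop:
  assumes "represents s V r fs"
  shows "\<exists>t s' es. exec w M I (While step_guard step_com) s t s' \<and>
    t \<le> step_time * (potential V r fs + 1) \<and>
    output_tape s' = output_tape s @ concat (map encode_event es) \<and>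
    dfs_from G (map fst fs) V es"
  using assms
\<comment> \<open>Every iteration lowers the potential; the additional 1 in the time bound pays for
  the final test of the guard.\<close>
proof (induction "potential V r fs" arbitrary: s V r fs rule: less_induct)
  case less
  have R: "r \<le> n" "V \<subseteq> {..<n}" "{..<r} \<subseteq> V" "regs s 0 = r" "frames V r fs"
    using less.prems by (auto simp: represents_def)
  have guard: "eval w I (regs s) step_guard = of_bool (r < n)"
    using R by (simp add: step_guard_def)
  show ?case
  proof (cases "r < n")
    case True
    obtain s1 V1 r1 fs1 evs where step: "run w M I step_com s = Some s1"
        "represents s1 V1 r1 fs1" "potential V1 r1 fs1 < potential V r fs"
        "output_tape s1 = output_tape s @ concat (map encode_event evs)"
        "\<And>es. dfs_from G (map fst fs1) V1 es \<Longrightarrow> dfs_from G (map fst fs) V (evs @ es)"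
      using simulates_step_com[OF less.prems True] unfolding simulates_step_def by blast
    obtain t1 where t1: "t1 \<le> com_nodes step_com" "exec w M I step_com s t1 s1"
      using exec_if_run[OF step(1)] by blast
    obtain t2 s2 es where IH: "exec w M I (While step_guard step_com) s1 t2 s2"
        "t2 \<le> step_time * (potential V1 r1 fs1 + 1)"
        "output_tape s2 = output_tape s1 @ concat (map encode_event es)"
        "dfs_from G (map fst fs1) V1 es"
      using less.hyps[OF step(3,2)] by blast
    have "exec w M I (While step_guard step_com) s (1 + exp_nodes step_guard + t1 + t2) s2"
      using guard True by (intro exec.while_true[OF _ t1(2) IH(1)]) simp
    moreover have "1 + exp_nodes step_guard + t1 + t2 \<le> step_time * (potential V r fs + 1)"
    proof -
      have "1 + exp_nodes step_guard + t1 + t2 \<le> step_time + step_time * (potential V1 r1 fs1 + 1)"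
        using t1(1) IH(2) by (simp add: step_time_def)
      also have "\<dots> = step_time * (potential V1 r1 fs1 + 2)"
        by (simp add: algebra_simps)
      also have "\<dots> \<le> step_time * (potential V r fs + 1)"
        using step(3) by (intro mult_le_mono2) simp
      finally show ?thesis .
    qed
    ultimately show ?thesis
      using IH(3,4) step(4,5)
      by (intro exI[of _ "1 + exp_nodes step_guard + t1 + t2"] exI[of _ s2] exI[of _ "evs @ es"])
        simp
  next
    case False
    then have V: "V = {..<n}" "r = n"
      using R by auto
    \<comment> \<open>A bottom frame would have vertex \<open>r = n\<close>, which is not a vertex
      of the graph.\<close>
    have "fs = []"
    proof (rule ccontr)
      assume "fs \<noteq> []"
      then have "r \<in> fst ` set fs"
        using R(5) by (auto simp: frames_def)
      then show False
        using frames_vertices[OF R(5,2)] False by blast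
    qed
    moreover have "exec w M I (While step_guard step_com) s (1 + exp_nodes step_guard) s"
      using guard False by (intro exec.while_false) simp
    moreover have "1 + exp_nodes step_guard \<le> step_time * (potential V r fs + 1)"
      by (simp add: step_time_def)
    ultimately show ?thesis
      using V
      by (intro exI[of _ "1 + exp_nodes step_guard"] exI[of _ s] exI[of _ "[]"])
        (simp add: dfs_from.stop pverts_eq)
  qed
qed

lemma exec_dfs:
  "\<exists>t s es. exec w M I dfs_com initial_state t s \<and> t \<le> dfs_time * (n + a) \<and>
    dfs_traversal G es \<and> output_tape s = concat (map encode_event es)"
proof -
  define s0 where "s0 = initial_state\<lparr>regs := (\<lambda>_. 0)(5 := base, 4 := 1)\<rparr>"
  have "take_bit w (n div w) = n div w" "take_bit w base = base"
    using div_le_dividend[of n w] by (simp_all add: M_def)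
  then have init: "run w M I init_com initial_state = Some s0"
    using word_length(1) by (simp add: init_com_def s0_def initial_state_def)
  obtain t0 where t0: "t0 \<le> com_nodes init_com" "exec w M I init_com initial_state t0 s0"
    using exec_if_run[OF init] by blast
  have "represents s0 {} 0 []"
    by (simp add: represents_def frames_def bitmap_def packed_stack_def s0_def initial_state_def)
  from exec_loop[OF this] obtain t1 s es where loop:
      "exec w M I (While step_guard step_com) s0 t1 s" "t1 \<le> step_time * (potential {} 0 [] + 1)"
      "output_tape s = output_tape s0 @ concat (map encode_event es)" "dfs_from G [] {} es"
    by auto
  have "potential {} 0 [] = 3 * n + a"
    by (simp add: potential_def sum.distrib sum_outdeg del: add_2_eq_Suc')
  then have "potential {} 0 [] + 1 \<le> 4 * (n + a)"
    using n_pos by simp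
  then have "t1 \<le> step_time * (4 * (n + a))"
    by (rule order_trans[OF loop(2) mult_le_mono2])
  moreover have "1 + t0 \<le> (1 + com_nodes init_com) * (n + a)"
    using t0(1) n_pos by (intro order_trans[OF _ mult_le_mono2[of 1 "n + a"]]) auto
  ultimately have "1 + t0 + t1 \<le> dfs_time * (n + a)"
    by (simp add: dfs_time_def algebra_simps)
  moreover have "exec w M I dfs_com initial_state (1 + t0 + t1) s"
    unfolding dfs_com_def by (rule exec.seq[OF t0(2) loop(1)])
  ultimately show ?thesis
    using loop(3,4) by (auto simp: dfs_traversal_def s0_def initial_state_def)
qed

text \<open>Counting \<open>w - 1\<close> bits per full word costs a factor
  \<open>w / (w - 1) = 1 + 1 / (w - 1)\<close>, which gives the last summand. The bitmap takes at
  most \<open>n + w\<close> bits.\<close>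

lemma space_le:
  "real (w * M) \<le> 2 * a + 3 * n + 2 * real w + (2 * a + 2 * n) / (real w - 1)"
proof -
  have w: "0 < real w - 1"
    using word_length(1) by simp
  have "real stack_words \<le> (2 * a + 2 * n) / (real w - 1)"
    using of_nat_div_le_of_nat[of "2 * a + 2 * n" "w - 1", where ?'a = real] word_length(1) by (simp add: of_nat_diff)
  then have "real w * stack_words \<le> real w * ((2 * a + 2 * n) / (real w - 1))"
    by (rule mult_left_mono) simp
  also have "\<dots> = (2 * a + 2 * n) + (2 * a + 2 * n) / (real w - 1)"
    using w by (simp add: field_simps)
  finally have "real (w * stack_words) \<le> (2 * a + 2 * n) + (2 * a + 2 * n) / (real w - 1)"
    by simp
  moreover have "w * (n div w) \<le> n"
    by simp
  then have "real (w * (n div w)) \<le> n"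
    by linarith
  ultimately show ?thesis
    by (simp add: M_def algebra_simps)
qed

end

section \<open>Asymptotic bounds\<close>

text \<open>The first summand accounts for the program nodes and for rounding. The second dominates
  \<open>(2 * a + 2 * n) / (w - 1)\<close>, as \<open>a <= 2 * m\<close> and
  \<open>w - 1 >= 1 + log 2 x\<close> for \<open>x = n + m\<close>.\<close>

definition space_error :: "nat \<Rightarrow> real \<Rightarrow> real" where
  "space_error w x = (com_nodes dfs_com + 2) * real w + 4 * (x / (1 + log 2 x))"

text \<open>Requiring only at most \<open>2 * m\<close> arcs admits both readings of
  \<open>m\<close>, arcs and undirected edges.\<close>

lemma performs_dfs_dfs_com:
  assumes fin: "pair_fin_digraph G" and conn: "Digraph_Component.connected (with_proj G)"
    and stores: "stores_digraph I G"
    and n: "n = card (pverts G)" and m: "card (parcs G) \<le> 2 * m"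
    and w: "real 3 + log 2 (real (n + m)) \<le> real w"
    and space: "2 * card (parcs G) + 3 * n + space_error w (n + m) \<le> space"
  shows "performs_dfs dfs_com w I G (2 * dfs_time * real (n + m)) space"
proof -
  have ne: "pverts G \<noteq> {}"
    using conn by (simp add: connected_def strongly_connected_def mk_symmetric_def)
  moreover have "finite (pverts G)"
    using fin by (simp add: pair_fin_digraph_def pair_fin_digraph_axioms_def)
  ultimately have n1: "1 \<le> n"
    using n by (simp add: Suc_le_eq card_gt_0_iff)
  have log0: "0 \<le> log 2 (real (n + m))"
    using n1 by simp
  have "3 \<le> w"
    using w log0 by linarith
  \<comment> \<open>The constant 3 is the logarithm of 8, and \<open>8 * (n + m)\<close> covers four
    times the vertices and arcs.\<close>
  have "8 * real (n + m) = 2 powr (3 + log 2 (real (n + m)))"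
    using n1 by (simp add: powr_add)
  also have "\<dots> \<le> 2 powr real w"
    using w by simp
  finally have "real (8 * (n + m)) \<le> real (2 ^ w)"
    by (simp add: powr_realpow)
  then have "8 * (n + m) \<le> 2 ^ w"
    by (simp only: of_nat_le_iff)
  moreover have "4 * (card (pverts G) + card (parcs G)) \<le> 8 * (n + m)"
    using m n by simp
  ultimately have "4 * (card (pverts G) + card (parcs G)) \<le> 2 ^ w"
    by (rule order_trans[rotated])
  with fin stores ne \<open>3 \<le> w\<close> interpret dfs_input G I w
    by (intro dfs_input.intro)
  have n_eq: "num_vertices I = n"
    using n by (simp add: pverts_eq)
  obtain t s es where dfs: "exec w M I dfs_com initial_state t s" "t \<le> dfs_time * (n + card (parcs G))"
      "dfs_traversal G es" "output_tape s = concat (map encode_event es)"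
    using exec_dfs unfolding n_eq by blast
  have "dfs_time * (n + card (parcs G)) \<le> dfs_time * (2 * (n + m))"
    using m by (intro mult_le_mono2) simp
  then have "t \<le> dfs_time * (2 * (n + m))"
    using dfs(2) by linarith
  then have "real t \<le> real (dfs_time * (2 * (n + m)))"
    by (simp only: of_nat_le_iff)
  then have "real t \<le> 2 * dfs_time * real (n + m)"
    by (simp add: algebra_simps)
  moreover have "real (w * (M + com_nodes dfs_com)) \<le> space"
  proof -
    have "(2 * card (parcs G) + 2 * n) / (real w - 1) \<le> (4 * real (n + m)) / (1 + log 2 (real (n + m)))"
      using m w log0 by (intro frac_le) auto
    then have "real (w * M) \<le> 2 * card (parcs G) + 3 * n + 2 * real w +
        4 * (real (n + m) / (1 + log 2 (real (n + m))))"
      using space_le unfolding n_eq by simp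
    then show ?thesis
      using space by (simp add: space_error_def algebra_simps)
  qed
  ultimately show ?thesis
    unfolding performs_dfs_def using dfs(1,3,4) by blast
qed

text \<open>The arcs are split by orientation; within each half an arc is determined by its set of
  endpoints.\<close>

lemma card_parcs_le_undirected_edges:
  assumes "finite (parcs G)"
  shows "card (parcs G) \<le> 2 * card (undirected_edges G)"
proof -
  let ?f = "\<lambda>(u, v). {u, v}"
  let ?A = "{(u, v) \<in> parcs G. u < v}" and ?B = "{(u, v) \<in> parcs G. v \<le> u}"
  have fin: "finite (undirected_edges G)"
    using assms by (simp add: undirected_edges_def)
  have "inj_on ?f ?A" "inj_on ?f ?B"
    by (auto simp: inj_on_def doubleton_eq_iff)
  then have "card ?A \<le> card (undirected_edges G)" "card ?B \<le> card (undirected_edges G)"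
    using fin by (auto intro!: card_inj_on_le simp: undirected_edges_def)
  moreover have "parcs G = ?A \<union> ?B" by auto
  then have "card (parcs G) \<le> card ?A + card ?B"
    using card_Un_le[of ?A ?B] by simp
  ultimately show ?thesis by linarith
qed

lemma pair_graph_arcs:
  assumes "pair_graph G"
  shows "pair_fin_digraph G" "card (parcs G) \<le> 2 * card (undirected_edges G)"
proof -
  interpret pair_graph G by (rule assms)
  show "pair_fin_digraph G"
    by unfold_locales
  show "card (parcs G) \<le> 2 * card (undirected_edges G)"
    by (rule card_parcs_le_undirected_edges) simp
qed

lemma filterlim_graph_size: "filterlim graph_size at_top large_graphs"
  unfolding large_graphs_def by (rule filterlim_filtercomap)

text \<open>The logarithm tends to infinity, so \<open>x / (1 + log 2 x)\<close> is in
  \<open>o(x)\<close>; composition with \<open>graph_size\<close> transfers this to pairs.\<close>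

lemma space_error_smallo:
  assumes "(\<lambda>p. real (W p)) \<in> o[large_graphs](graph_size)"
  shows "(\<lambda>p. space_error (W p) (graph_size p)) \<in> o[large_graphs](graph_size)"
proof -
  have "filterlim (\<lambda>x::real. 1 / ln 2 * ln x) at_top at_top"
    by (rule filterlim_tendsto_pos_mult_at_top[OF tendsto_const _ ln_at_top]) simp
  then have "filterlim (\<lambda>x. 1 + log 2 x) at_top at_top"
    by (intro filterlim_tendsto_add_at_top[OF tendsto_const]) (simp add: log_def)
  then have "((\<lambda>x. 1 / (1 + log 2 x)) \<longlongrightarrow> 0) at_top"
    by (intro tendsto_divide_0[OF tendsto_const] filterlim_at_top_imp_at_infinity)
  moreover have "\<forall>\<^sub>F x in at_top. 1 / (1 + log 2 x) = x / (1 + log 2 x) / x"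
    using eventually_gt_at_top[of 0] by eventually_elim simp
  ultimately have "((\<lambda>x. x / (1 + log 2 x) / x) \<longlongrightarrow> 0) at_top"
    by (rule Lim_transform_eventually)
  then have "(\<lambda>x. x / (1 + log 2 x)) \<in> o[at_top](\<lambda>x::real. x)"
    using eventually_gt_at_top[of 0] by (intro smalloI_tendsto) (auto elim: eventually_mono)
  then have "(\<lambda>p. graph_size p / (1 + log 2 (graph_size p))) \<in> o[large_graphs](graph_size)"
    by (rule landau_o.small.compose[OF _ filterlim_graph_size])
  then have "(\<lambda>p. 4 * (graph_size p / (1 + log 2 (graph_size p)))) \<in> o[large_graphs](graph_size)"
    by (subst landau_o.small.cmult_in_iff) simp_all
  moreover have "(\<lambda>p. (com_nodes dfs_com + 2) * real (W p)) \<in> o[large_graphs](graph_size)"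
    using assms by (subst landau_o.small.cmult_in_iff) simp_all
  ultimately show ?thesis
    unfolding space_error_def by (rule sum_in_smallo(1)[rotated])
qed

text \<open>The predicate \<open>A\<close> abstracts from the class of graphs. Both claims are
  instances, with \<open>c = 2\<close> for \<open>m\<close> arcs and \<open>c = 4\<close> for at
  most \<open>2 * m\<close> arcs.\<close>

lemma dfs_com_asymptotics:
  fixes A :: "nat pair_pre_digraph \<Rightarrow> adjacency \<Rightarrow> nat \<Rightarrow> nat \<Rightarrow> bool" and c :: real
  assumes A: "\<And>G I n m. A G I n m \<Longrightarrow>
      pair_fin_digraph G \<and> Digraph_Component.connected (with_proj G) \<and> stores_digraph I G \<and>
      n = card (pverts G) \<and> card (parcs G) \<le> 2 * m \<and> 2 * real (card (parcs G)) \<le> c * real m"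
  shows "\<exists>(P :: com) (\<kappa> :: nat) (T :: nat \<times> nat \<Rightarrow> real).
      T \<in> O[large_graphs](graph_size) \<and>
      (\<forall>W :: nat \<times> nat \<Rightarrow> nat. (\<lambda>p. real (W p)) \<in> o[large_graphs](graph_size) \<longrightarrow>
         (\<exists>\<sigma> :: nat \<times> nat \<Rightarrow> real. \<sigma> \<in> o[large_graphs](graph_size) \<and>
            (\<forall>G I n m. A G I n m \<and> real \<kappa> + log 2 (real (n + m)) \<le> real (W (n, m)) \<longrightarrow>
               performs_dfs P (W (n, m)) I G (T (n, m)) (c * real m + 3 * real n + \<sigma> (n, m)))))"
proof (intro exI conjI allI impI)
  show "(\<lambda>p. 2 * dfs_time * graph_size p) \<in> O[large_graphs](graph_size)"
    by simp
next
  fix W :: "nat \<times> nat \<Rightarrow> nat"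
  assume W: "(\<lambda>p. real (W p)) \<in> o[large_graphs](graph_size)"
  then show "(\<lambda>p. space_error (W p) (graph_size p)) \<in> o[large_graphs](graph_size)"
    by (rule space_error_smallo)
  fix G I n m
  assume "A G I n m \<and> real 3 + log 2 (real (n + m)) \<le> real (W (n, m))"
  then show "performs_dfs dfs_com (W (n, m)) I G (2 * dfs_time * graph_size (n, m))
      (c * real m + 3 * real n + space_error (W (n, m)) (graph_size (n, m)))"
    using A[of G I n m] performs_dfs_dfs_com[of G I n m "W (n, m)"] by simp
qed

theorem theorem17:
  shows
    "(\<exists>(P :: com) (\<kappa> :: nat) (T :: nat \<times> nat \<Rightarrow> real).
        T \<in> O[large_graphs](graph_size) \<and>
        (\<forall>W :: nat \<times> nat \<Rightarrow> nat.
           (\<lambda>p. real (W p)) \<in> o[large_graphs](graph_size) \<longrightarrow>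
           (\<exists>\<sigma> :: nat \<times> nat \<Rightarrow> real.
              \<sigma> \<in> o[large_graphs](graph_size) \<and>
              (\<forall>(G :: nat pair_pre_digraph) (I :: adjacency) (n :: nat) (m :: nat).
                 pair_fin_digraph G \<and> Digraph_Component.connected (with_proj G) \<and>
                 n = card (pverts G) \<and> m = card (parcs G) \<and>
                 stores_digraph I G \<and>
                 real \<kappa> + log 2 (real (n + m)) \<le> real (W (n, m)) \<longrightarrow>
                 performs_dfs P (W (n, m)) I G (T (n, m))
                   (2 * real m + 3 * real n + \<sigma> (n, m))))))
     \<and>
     (\<exists>(P :: com) (\<kappa> :: nat) (T :: nat \<times> nat \<Rightarrow> real).
        T \<in> O[large_graphs](graph_size) \<and>
        (\<forall>W :: nat \<times> nat \<Rightarrow> nat.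
           (\<lambda>p. real (W p)) \<in> o[large_graphs](graph_size) \<longrightarrow>
           (\<exists>\<sigma> :: nat \<times> nat \<Rightarrow> real.
              \<sigma> \<in> o[large_graphs](graph_size) \<and>
              (\<forall>(G :: nat pair_pre_digraph) (I :: adjacency) (n :: nat) (m :: nat).
                 pair_graph G \<and> Digraph_Component.connected (with_proj G) \<and>
                 n = card (pverts G) \<and> m = card (undirected_edges G) \<and>
                 stores_graph I G \<and>
                 real \<kappa> + log 2 (real (n + m)) \<le> real (W (n, m)) \<longrightarrow>
                 performs_dfs P (W (n, m)) I G (T (n, m))
                   (4 * real m + 3 * real n + \<sigma> (n, m))))))"
proof -
  note directed = dfs_com_asymptotics[of "\<lambda>G I n m. pair_fin_digraph G \<and>
      Digraph_Component.connected (with_proj G) \<and> n = card (pverts G) \<and> m = card (parcs G) \<and>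
      stores_digraph I G" 2, unfolded conj_assoc]
  note undirected = dfs_com_asymptotics[of "\<lambda>G I n m. pair_graph G \<and>
      Digraph_Component.connected (with_proj G) \<and> n = card (pverts G) \<and>
      m = card (undirected_edges G) \<and> stores_graph I G" 4, unfolded conj_assoc]
  show ?thesis
    using pair_graph_arcs by (intro conjI directed undirected) (force simp: stores_graph_def)+
qed

end
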